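(* Let $k\ne h$ be positive integers and let $n$ be a positive integer such that $n>1$ or $k+h$ is odd (or both). Then $$\zeta(n,k,h)=\mathcal{Z}(2n,k,h).$$
   Context: A primitive prime divisor of the $n$-th term of a sequence (indexed by positive integers) is a prime dividing the $n$-th term and no earlier term. $\mathcal{Z}(n,k,h)$ is the product of the primitive prime divisors of the term $k^n-h^n$ of the sequence $(k^u-h^u)_{u\ge1}$, and $\zeta(n,k,h)$ is the product of the primitive prime divisors of the term $k^n+h^n$ of the sequence $(k^u+h^u)_{u\ge1}$; in both cases each prime is counted with the multiplicity with which it divides the term (empty product $=1$).
   Formalization: For n = 1 the formal statement also assumes that k and h are coprime; without this the claim fails, e.g. k = 3, h = 6, n = 1 gives ζ = 9 but Z(2,3,6) = 1, and it fails for every excluded pair. *)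

theory Defs
  imports "HOL-Computational_Algebra.Primes"
begin

(* Sequences are indexed by the positive integers: the value of a at 0 is never used. *)
definition primitive_prime_divisors :: "(nat \<Rightarrow> int) \<Rightarrow> nat \<Rightarrow> int set" where
  "primitive_prime_divisors a n =
     {p. prime p \<and> p dvd a n \<and> (\<forall>m. 1 \<le> m \<and> m < n \<longrightarrow> \<not> p dvd a m)}"

(* Meaningful only if a n is nonzero: only then is the index set guaranteed to be finite. *)
definition primitive_part :: "(nat \<Rightarrow> int) \<Rightarrow> nat \<Rightarrow> int" where
  "primitive_part a n = (\<Prod>p\<in>primitive_prime_divisors a n. p ^ multiplicity p (a n))"

definition prim_diff :: "nat \<Rightarrow> int \<Rightarrow> int \<Rightarrow> int" where
  "prim_diff n k h = primitive_part (\<lambda>u. k ^ u - h ^ u) n"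

definition prim_sum :: "nat \<Rightarrow> int \<Rightarrow> int \<Rightarrow> int" where
  "prim_sum n k h = primitive_part (\<lambda>u. k ^ u + h ^ u) n"

end

(* Primitive divisors of k^n + h^n divide k^(2n) - h^(2n) = (k^n - h^n)(k^n + h^n).  If such a
   p also divided k^m - h^m with m < 2n, then cancelling a power of h (which p does not divide)
   would turn k^n = -h^n and k^m = h^m (mod p) into k^j = -h^j with j = |n - m| < n, against
   primitivity; for j = 0 this reads 1 = -1, excluded because p is odd. *)
theory Submission
  imports Defs
begin

lemma primitive_part_cong:
  assumes "primitive_prime_divisors a m = primitive_prime_divisors b n"
    and "\<And>p. p \<in> primitive_prime_divisors b n \<Longrightarrow> multiplicity p (a m) = multiplicity p (b n)"
  shows "primitive_part a m = primitive_part b n"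
  unfolding primitive_part_def using assms by (intro prod.cong) auto

lemma power_double_diff:
  fixes k h :: "'a::comm_ring_1"
  shows "k ^ (2 * n) - h ^ (2 * n) = (k ^ n - h ^ n) * (k ^ n + h ^ n)"
  unfolding mult_2 power_add by (simp add: algebra_simps)

text \<open>The exponent is |n - m|, split into two cases because subtraction on \<open>nat\<close>
  truncates. For m = n it is 0, and the conclusion becomes p dvd 2.\<close>

lemma prime_dvd_power_diff_imp_dvd_power_sum:
  fixes p k h :: int
  assumes p: "prime p" and ph: "\<not> p dvd h"
    and sum: "p dvd k ^ n + h ^ n" and diff: "p dvd k ^ m - h ^ m"
  shows "p dvd k ^ (if m \<le> n then n - m else m - n) + h ^ (if m \<le> n then n - m else m - n)"
proof (cases "m \<le> n")
  case True
  then obtain j where n: "n = m + j" using le_Suc_ex by blast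
  \<comment> \<open>Writes k^n as k^j * k^m and trades k^m for h^m modulo p; the other case trades
    k^n for -h^n in k^m.\<close>
  have "h ^ m * (k ^ j + h ^ j) = (k ^ n + h ^ n) - k ^ j * (k ^ m - h ^ m)"
    by (simp add: n power_add algebra_simps)
  then have "p dvd h ^ m * (k ^ j + h ^ j)"
    using sum diff by simp
  then show ?thesis
    using True p ph n by (auto simp: prime_dvd_mult_iff dest: prime_dvd_power)
next
  case False
  then obtain j where m: "m = n + j" using le_Suc_ex nat_le_linear by blast
  have "h ^ n * (k ^ j + h ^ j) = k ^ j * (k ^ n + h ^ n) - (k ^ m - h ^ m)"
    by (simp add: m power_add algebra_simps)
  then have "p dvd h ^ n * (k ^ j + h ^ j)"
    using sum diff by simp
  then show ?thesis
    using False p ph m by (auto simp: prime_dvd_mult_iff dest: prime_dvd_power)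
qed

lemma primitive_prime_divisors_diff_subset_sum:
  fixes k h :: int
  assumes "n > 0"
  shows "primitive_prime_divisors (\<lambda>u. k ^ u - h ^ u) (2 * n)
    \<subseteq> primitive_prime_divisors (\<lambda>u. k ^ u + h ^ u) n"
proof
  fix p
  assume "p \<in> primitive_prime_divisors (\<lambda>u. k ^ u - h ^ u) (2 * n)"
  then have p: "prime p" "p dvd k ^ (2 * n) - h ^ (2 * n)"
    and prim: "\<And>m. 1 \<le> m \<Longrightarrow> m < 2 * n \<Longrightarrow> \<not> p dvd k ^ m - h ^ m"
    by (auto simp: primitive_prime_divisors_def)
  \<comment> \<open>Primitivity at the index n < 2n rules out the factor k^n - h^n.\<close>
  have "p dvd k ^ n + h ^ n"
    using p prim[of n] assms by (simp add: power_double_diff prime_dvd_mult_iff)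
  \<comment> \<open>k^m + h^m divides the earlier term k^(2m) - h^(2m), as 2m < 2n.\<close>
  moreover have "\<not> p dvd k ^ m + h ^ m" if "1 \<le> m" "m < n" for m
    using prim[of "2 * m"] that by (auto simp: power_double_diff)
  ultimately show "p \<in> primitive_prime_divisors (\<lambda>u. k ^ u + h ^ u) n"
    using p(1) by (simp add: primitive_prime_divisors_def)
qed

text \<open>For n > 1, primitivity at index 1 gives that p does not divide k + h, which excludes
  both p dvd h and p = 2. For n = 1 there is no earlier term, so coprimality and the parity of k + h
  must do this. With k = 6, h = 3, n = 1 the prime 3 divides k + h but also k - h, so the inclusion
  fails.\<close>

lemma primitive_prime_divisors_sum_subset_diff:
  fixes k h :: int
  assumes "n > 0" and odd: "n > 1 \<or> odd (k + h)" and copr: "n = 1 \<Longrightarrow> coprime k h"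
  shows "primitive_prime_divisors (\<lambda>u. k ^ u + h ^ u) n
    \<subseteq> primitive_prime_divisors (\<lambda>u. k ^ u - h ^ u) (2 * n)"
proof
  fix p
  assume "p \<in> primitive_prime_divisors (\<lambda>u. k ^ u + h ^ u) n"
  then have p: "prime p" and sum: "p dvd k ^ n + h ^ n"
    and prim: "\<And>m. 1 \<le> m \<Longrightarrow> m < n \<Longrightarrow> \<not> p dvd k ^ m + h ^ m"
    by (auto simp: primitive_prime_divisors_def)
  have ph: "\<not> p dvd h"
  proof
    assume "p dvd h"
    then have "p dvd k ^ n"
      using sum \<open>n > 0\<close> dvd_power_le[of p h 1 n] by (simp add: dvd_add_left_iff)
    then have "p dvd k"
      using p prime_dvd_power by blast
    then show False
      using \<open>p dvd h\<close> prim[of 1] copr \<open>n > 0\<close> p not_prime_unit coprime_common_divisor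
      by (cases "n = 1") auto
  qed
  have "p \<noteq> 2"
    using sum prim[of 1] odd \<open>n > 0\<close> by (cases "n = 1") auto
  then have p2: "\<not> p dvd 2"
    using p primes_dvd_imp_eq two_is_prime_nat by (metis prime_int_numeral_eq two_is_prime_nat)
  have "\<not> p dvd k ^ m - h ^ m" if "1 \<le> m" "m < 2 * n" for m
  proof
    assume "p dvd k ^ m - h ^ m"
    note dvd = prime_dvd_power_diff_imp_dvd_power_sum[OF p ph sum this]
    \<comment> \<open>If m = n, then p dvd 2. Otherwise 1 \<le> m bounds n - m and m < 2n bounds m -
      n strictly below n, so primitivity applies.\<close>
    show False
      using dvd p2 that prim[of "n - m"] prim[of "m - n"]
      by (cases m n rule: linorder_cases) auto
  qed
  then show "p \<in> primitive_prime_divisors (\<lambda>u. k ^ u - h ^ u) (2 * n)"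
    using p sum by (simp add: primitive_prime_divisors_def power_double_diff)
qed

theorem theorem11:
  fixes k h :: int and n :: nat
  assumes "k > 0" and "h > 0" and "k \<noteq> h" and "n > 0"
    and "n > 1 \<or> odd (k + h)"
    and "n = 1 \<Longrightarrow> coprime k h"
  shows "prim_sum n k h = prim_diff (2 * n) k h"
  unfolding prim_sum_def prim_diff_def
proof (rule primitive_part_cong)
  show "primitive_prime_divisors (\<lambda>u. k ^ u + h ^ u) n
    = primitive_prime_divisors (\<lambda>u. k ^ u - h ^ u) (2 * n)"
    using assms by (intro equalityI primitive_prime_divisors_sum_subset_diff
        primitive_prime_divisors_diff_subset_sum)
next
  \<comment> \<open>It remains to match exponents: p does not divide k^n - h^n, so every factor p of
    the product comes from k^n + h^n. Multiplicities add only for nonzero factors, hence the two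
    inequations.\<close>
  fix p
  assume "p \<in> primitive_prime_divisors (\<lambda>u. k ^ u - h ^ u) (2 * n)"
  then have p: "prime p" and "\<not> p dvd k ^ n - h ^ n"
    using \<open>n > 0\<close> by (auto simp: primitive_prime_divisors_def)
  moreover from this have "k ^ n - h ^ n \<noteq> 0" by auto
  moreover have "k ^ n + h ^ n \<noteq> 0"
    using assms by (simp add: add_pos_pos less_imp_neq[symmetric])
  ultimately show "multiplicity p (k ^ n + h ^ n) = multiplicity p (k ^ (2 * n) - h ^ (2 * n))"
    using prime_elem_multiplicity_mult_distrib[OF prime_imp_prime_elem[OF p],
        of "k ^ n - h ^ n" "k ^ n + h ^ n"]
    by (simp add: power_double_diff not_dvd_imp_multiplicity_0)
qed

end
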